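(* Let $p\le q$ be primes, let $G$ be a (not necessarily finite) group with $\left|G/Z(G)\right|=pq$, and let $H$ be a non-abelian subgroup of $G$. Then $G$ is isoclinic with $H$. In particular, $|\mathrm{Cent}(G)|=|\mathrm{Cent}(H)|=q+2$.
   Context: $\mathrm{Cent}(G)=\{C_G(x): x\in G\}$ is the set of centralizers of elements of $G$. Two groups $G$ and $H$ are isoclinic if there are isomorphisms $\varphi:G/Z(G)\to H/Z(H)$ and $\phi:G'\to H'$ (where $'$ denotes the commutator subgroup) such that whenever $\varphi(g_iZ(G))=h_iZ(H)$ for $i=1,2$ ($g_i\in G$, $h_i\in H$), one has $\phi([g_1,g_2])=[h_1,h_2]$. *)

theory Defs
  imports "HOL-Algebra.Generated_Groups" "HOL-Computational_Algebra.Primes"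
begin

definition centralizer :: "('a, 'm) monoid_scheme \<Rightarrow> 'a \<Rightarrow> 'a set" where
  "centralizer G x = {y \<in> carrier G. x \<otimes>\<^bsub>G\<^esub> y = y \<otimes>\<^bsub>G\<^esub> x}"

definition Cent :: "('a, 'm) monoid_scheme \<Rightarrow> 'a set set" where
  "Cent G = centralizer G ` carrier G"

definition center :: "('a, 'm) monoid_scheme \<Rightarrow> 'a set" where
  "center G = {z \<in> carrier G. \<forall>x \<in> carrier G. z \<otimes>\<^bsub>G\<^esub> x = x \<otimes>\<^bsub>G\<^esub> z}"

(* Same convention as the generators of derived G (carrier G).  The other common convention,
   (inv x)(inv y)xy, is this one applied to the inverses of x and y; replacing one by the other
   does not change the isoclinism relation below. *)
definition commutator :: "('a, 'm) monoid_scheme \<Rightarrow> 'a \<Rightarrow> 'a \<Rightarrow> 'a" where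
  "commutator G x y = x \<otimes>\<^bsub>G\<^esub> y \<otimes>\<^bsub>G\<^esub> inv\<^bsub>G\<^esub> x \<otimes>\<^bsub>G\<^esub> inv\<^bsub>G\<^esub> y"

definition commutator_subgroup :: "('a, 'm) monoid_scheme \<Rightarrow> ('a, 'm) monoid_scheme" where
  "commutator_subgroup G = G\<lparr>carrier := derived G (carrier G)\<rparr>"

(* Intended for groups G and H.  Cosets of the (normal) center are written as right cosets,
   the representation used by Mod. *)
definition isoclinic :: "('a, 'm) monoid_scheme \<Rightarrow> ('b, 'n) monoid_scheme \<Rightarrow> bool" where
  "isoclinic G H \<longleftrightarrow>
    (\<exists>\<phi> \<in> iso (G Mod center G) (H Mod center H).
     \<exists>\<psi> \<in> iso (commutator_subgroup G) (commutator_subgroup H).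
       \<forall>g\<^sub>1 \<in> carrier G. \<forall>g\<^sub>2 \<in> carrier G. \<forall>h\<^sub>1 \<in> carrier H. \<forall>h\<^sub>2 \<in> carrier H.
         \<phi> (center G #>\<^bsub>G\<^esub> g\<^sub>1) = center H #>\<^bsub>H\<^esub> h\<^sub>1 \<longrightarrow>
         \<phi> (center G #>\<^bsub>G\<^esub> g\<^sub>2) = center H #>\<^bsub>H\<^esub> h\<^sub>2 \<longrightarrow>
         \<psi> (commutator G g\<^sub>1 g\<^sub>2) = commutator H h\<^sub>1 h\<^sub>2)"

end

theory Submission
  imports Defs "HOL-Algebra.Sylow"
begin

text \<open>
  A subgroup whose image modulo the center is trivial or of prime order is abelian. So a non-abelian
  \<open>H\<close> maps onto the quotient by the center, that is, every element of \<open>G\<close> is a central element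
  times an element of \<open>H\<close>; this gives the isoclinism, with the identity on commutators.

  The centralizers of noncentral elements have images of order \<open>p\<close> or \<open>q\<close>, and being abelian they
  are equal as soon as they share a noncentral element. Their images thus partition the nontrivial
  elements of a group of order \<open>p * q\<close>. By Sylow one block \<open>A\<close> has order \<open>q\<close>; any other block
  \<open>B\<close> satisfies \<open>card A * card B \<le> p * q\<close> and so has order \<open>p\<close>. Counting elements leaves
  exactly \<open>q\<close> other blocks, and \<open>G\<close> itself is the remaining centralizer.
\<close>

section \<open>Subgroup orders and partitions of a group into subgroups\<close>

lemma prime_mult_divisors:
  fixes p q d :: nat
  assumes "prime p" "prime q" "d dvd p * q"
  shows "d = 1 \<or> d = p \<or> d = q \<or> d = p * q"
proof -
  obtain a b where ab: "d = a * b" "a dvd p" "b dvd q"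
    using division_decomp[OF assms(3)] by blast
  then have "a = 1 \<or> a = p" "b = 1 \<or> b = q"
    using assms(1,2) by (auto simp: prime_nat_iff)
  with ab(1) show ?thesis by auto
qed

context group
begin

lemma card_subgroup_dvd:
  assumes "subgroup A G" "subgroup B G" "A \<subseteq> B"
  shows "card A dvd card B"
proof -
  interpret B: group "G\<lparr>carrier := B\<rparr>" by (rule subgroup_imp_group[OF assms(2)])
  have "subgroup A (G\<lparr>carrier := B\<rparr>)" using assms by (simp add: subgroup_incl)
  then have "card A dvd order (G\<lparr>carrier := B\<rparr>)"
    using B.lagrange dvd_triv_right by metis
  then show ?thesis by (simp add: order_def)
qed

text \<open>If \<open>a \<otimes> b = c \<otimes> d\<close>, then
  \<open>inv c \<otimes> a = d \<otimes> inv b\<close> lies in both subgroups and is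
  \<open>\<one>\<close>; so multiplication is injective on \<open>A \<times> B\<close>.\<close>

lemma card_subgroups_mult_le:
  assumes "subgroup A G" "subgroup B G" "A \<inter> B = {\<one>}" "finite (carrier G)"
  shows "card A * card B \<le> order G"
proof -
  interpret A: subgroup A G by fact
  interpret B: subgroup B G by fact
  have "inj_on (\<lambda>(a, b). a \<otimes> b) (A \<times> B)"
  proof (rule inj_onI, clarsimp)
    fix a b c d assume h: "a \<in> A" "b \<in> B" "c \<in> A" "d \<in> B" "a \<otimes> b = c \<otimes> d"
    have car: "a \<in> carrier G" "b \<in> carrier G" "c \<in> carrier G" "d \<in> carrier G"
      using h A.subset B.subset by auto
    have eq: "inv c \<otimes> a = d \<otimes> inv b"
      by (metis h(5) car inv_closed inv_solve_left inv_solve_right m_assoc m_closed)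
    have "inv c \<otimes> a \<in> A" using h by simp
    moreover have "inv c \<otimes> a \<in> B" unfolding eq using h by simp
    ultimately have "inv c \<otimes> a = \<one>" using assms(3) by auto
    with car eq show "a = c \<and> b = d"
      by (metis inv_closed inv_equality inv_inv)
  qed
  then have "card ((\<lambda>(a, b). a \<otimes> b) ` (A \<times> B)) = card A * card B"
    by (simp add: card_image card_cartesian_product)
  moreover have "(\<lambda>(a, b). a \<otimes> b) ` (A \<times> B) \<subseteq> carrier G" by auto
  ultimately show ?thesis
    unfolding order_def using card_mono[OF assms(4)] by metis
qed

text \<open>Without the identity the members of \<open>F\<close> are disjoint. One has order
  \<open>q\<close> and all others order \<open>p\<close>, so
  \<open>p * q - 1 = (q - 1) + (card F - 1) * (p - 1)\<close>, which determines
  \<open>card F\<close>.\<close>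

lemma card_subgroup_partition:
  assumes p: "prime p" and q: "prime q" and "p \<le> q" and ord: "order G = p * q"
    and sub: "\<And>A. A \<in> F \<Longrightarrow> subgroup A G"
    and crd: "\<And>A. A \<in> F \<Longrightarrow> card A = p \<or> card A = q"
    and int: "\<And>A B. A \<in> F \<Longrightarrow> B \<in> F \<Longrightarrow> A \<noteq> B \<Longrightarrow> A \<inter> B = {\<one>}"
    and cover: "carrier G \<subseteq> \<Union>F"
  shows "card F = q + 1"
proof -
  have p1: "p > 1" and q1: "q > 1" using p q prime_gt_1_nat by auto
  have fin: "finite (carrier G)" using ord p1 q1 order_gt_0_iff_finite by simp
  have subs: "A \<subseteq> carrier G" if "A \<in> F" for A using sub[OF that] subgroup.subset by blast
  have finF: "finite F" using subs fin by (meson Pow_iff finite_Pow_iff finite_subset subsetI)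
  have finA: "finite A" if "A \<in> F" for A using subs[OF that] fin finite_subset by blast
  have "\<exists>A\<in>F. card A = q"
  proof -
    \<comment> \<open>Sylow is applied with exponent 1 and cofactor \<open>p\<close>. This covers
      \<open>p = q\<close> too, where \<open>S\<close> is not a full Sylow subgroup.\<close>
    obtain S where S: "subgroup S G" "card S = q"
      using sylow_thm[OF q, of G 1 p] ord fin group_axioms by (auto simp: mult.commute)
    obtain x where x: "x \<in> S" "x \<noteq> \<one>"
    proof -
      have "\<not> S \<subseteq> {\<one>}" using S(2) q1 card_mono[of "{\<one>}" S] by auto
      then show ?thesis using that by blast
    qed
    have xG: "x \<in> carrier G" using x(1) S(1) subgroup.subset by blast
    then obtain A where A: "A \<in> F" "x \<in> A" using cover by blast
    have SA: "subgroup (S \<inter> A) G" using subgroups_Inter_pair[OF S(1) sub[OF A(1)]] .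
    \<comment> \<open>The block through a nontrivial \<open>x \<in> S\<close> meets \<open>S\<close>
      in a nontrivial subgroup. As \<open>S\<close> has prime order, the intersection has order
      \<open>q\<close>, so \<open>q\<close> divides \<open>card A\<close>.\<close>
    have "card (S \<inter> A) \<noteq> 1"
      using x A(2) subgroup.one_closed[OF SA] by (metis IntI card_1_singletonE singletonD)
    then have "card (S \<inter> A) = q"
      using card_subgroup_dvd[OF SA S(1)] q S(2) by (auto simp: prime_nat_iff)
    then have "q dvd card A"
      using card_subgroup_dvd[OF SA sub[OF A(1)]] by simp
    then have "card A = q"
      using crd[OF A(1)] p q primes_dvd_imp_eq by metis
    then show ?thesis using A(1) by blast
  qed
  then obtain A0 where A0: "A0 \<in> F" "card A0 = q" by blast
  \<comment> \<open>A second block of order \<open>q\<close> would give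
    \<open>q * q \<le> p * q\<close>, hence \<open>p = q\<close>, so its order is \<open>p\<close>
    in any case.\<close>
  have others: "card A = p" if "A \<in> F - {A0}" for A
  proof (rule ccontr)
    assume n: "card A \<noteq> p"
    with crd that have cq: "card A = q" by blast
    have "A \<inter> A0 = {\<one>}" using int that A0 by blast
    from card_subgroups_mult_le[OF sub sub this fin] that A0 cq ord
    have "q * q \<le> p * q" by simp
    then have "q \<le> p" using q1 by simp
    with n cq \<open>p \<le> q\<close> show False by simp
  qed
  have oneA: "\<one> \<in> A" if "A \<in> F" for A using sub[OF that] subgroup.one_closed by blast
  have "carrier G - {\<one>} = (\<Union>A\<in>F. A - {\<one>})" using cover subs by blast
  then have "card (carrier G - {\<one>}) = (\<Sum>A\<in>F. card (A - {\<one>}))"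
    using int finA finF by (subst card_UN_disjoint[symmetric]) auto
  also have "\<dots> = (\<Sum>A\<in>F. card A - 1)"
    by (rule sum.cong) (auto simp: oneA finA)
  also have "\<dots> = (q - 1) + (\<Sum>A\<in>F - {A0}. card A - 1)"
    using sum.remove[OF finF A0(1), of "\<lambda>A. card A - 1"] A0(2) by simp
  also have "(\<Sum>A\<in>F - {A0}. card A - 1) = card (F - {A0}) * (p - 1)"
    using others by simp
  also have "card (F - {A0}) = card F - 1" using A0 finF by simp
  finally have "p * q - 1 = (q - 1) + (card F - 1) * (p - 1)"
    using fin ord by (simp add: order_def)
  moreover have "p * q - 1 = (q - 1) + q * (p - 1)"
  proof -
    \<comment> \<open>Writing \<open>p\<close> as a successor removes the truncated
      subtraction.\<close>
    obtain r where "p = Suc r" using p1 by (cases p) auto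
    then show ?thesis using q1 by (simp add: algebra_simps)
  qed
  \<comment> \<open>The factor \<open>p - 1\<close> cancels because \<open>p > 1\<close>. Since
    \<open>q > 0\<close>, the truncated \<open>card F - 1\<close> then yields
    \<open>card F = q + 1\<close>.\<close>
  ultimately have "card F - 1 = q" using p1 by simp
  then show ?thesis using q1 by simp
qed

section \<open>Centralizers, the center and the quotient by the center\<close>

lemma center_subset_carrier: "center G \<subseteq> carrier G"
  by (auto simp: center_def)

lemma subgroup_centralizer:
  assumes x: "x \<in> carrier G"
  shows "subgroup (centralizer G x) G"
proof (rule subgroupI)
  show "centralizer G x \<subseteq> carrier G" by (auto simp: centralizer_def)
  show "centralizer G x \<noteq> {}" using x by (auto simp: centralizer_def)
next
  fix a assume a: "a \<in> centralizer G x"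
  then have "a \<in> carrier G" "x \<otimes> a = a \<otimes> x" by (auto simp: centralizer_def)
  then show "inv a \<in> centralizer G x"
    using x by (simp add: centralizer_def) (metis inv_closed inv_solve_left inv_solve_right m_assoc m_closed)
next
  fix a b assume "a \<in> centralizer G x" "b \<in> centralizer G x"
  then show "a \<otimes> b \<in> centralizer G x"
    using x by (simp add: centralizer_def) (metis m_assoc)
qed

lemma center_subset_centralizer: "x \<in> carrier G \<Longrightarrow> center G \<subseteq> centralizer G x"
  by (auto simp: center_def centralizer_def)

lemma centralizer_eq_carrier_iff:
  assumes "x \<in> carrier G"
  shows "centralizer G x = carrier G \<longleftrightarrow> x \<in> center G"
  using assms by (auto simp: center_def centralizer_def)

lemma center_normal: "center G \<lhd> G"
proof -
  \<comment> \<open>As an intersection of centralizers the center inherits the subgroup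
    property.\<close>
  have "center G = (\<Inter>x\<in>carrier G. centralizer G x)"
    using one_closed by (auto simp: center_def centralizer_def)
  then have sub: "subgroup (center G) G"
    using subgroups_Inter[of "centralizer G ` carrier G"] subgroup_centralizer one_closed by auto
  show ?thesis
  proof (rule normal_invI[OF sub])
    fix x z assume h: "x \<in> carrier G" "z \<in> center G"
    then have "z \<in> carrier G" "x \<otimes> z = z \<otimes> x" by (auto simp: center_def)
    then have "x \<otimes> z \<otimes> inv x = z" using h by (simp add: m_assoc)
    then show "x \<otimes> z \<otimes> inv x \<in> center G" using h by simp
  qed
qed

lemma center_subgroup: "subgroup (center G) G"
  using center_normal by (rule normal_imp_subgroup)

lemma group_hom_center: "group_hom G (G Mod center G) (\<lambda>x. center G #> x)"
  by (intro group_hom.intro group_hom_axioms.intro is_group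
      normal.factorgroup_is_group normal.r_coset_hom_Mod center_normal)

lemma center_coset_image_subgroup:
  assumes "subgroup A G"
  shows "subgroup ((\<lambda>x. center G #> x) ` A) (G Mod center G)"
  using group_hom.subgroup_img_is_subgroup[OF group_hom_center assms] .

lemma center_coset_image_carrier:
  "(\<lambda>x. center G #> x) ` carrier G = carrier (G Mod center G)"
  by (auto simp: FactGroup_def RCOSETS_def)

lemma center_coset_eqD:
  assumes "center G #> a = center G #> b" "a \<in> carrier G" "b \<in> carrier G"
  obtains z where "z \<in> center G" "a = z \<otimes> b"
proof -
  have "a \<in> center G #> b"
    using rcos_self[OF assms(2) center_subgroup] assms(1) by simp
  then show ?thesis using that by (auto simp: r_coset_def)
qed

lemma center_coset_one_iff:
  assumes "x \<in> carrier G"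
  shows "center G #> x = center G \<longleftrightarrow> x \<in> center G"
  using coset_join1[OF _ assms center_subgroup] coset_join2[OF assms center_subgroup] by blast

text \<open>A subgroup containing the center is a union of its cosets, so membership can be tested
  in the quotient.\<close>

lemma mem_if_center_coset_mem_image:
  assumes "subgroup A G" "center G \<subseteq> A" "x \<in> carrier G"
    and "center G #> x \<in> (\<lambda>x. center G #> x) ` A"
  shows "x \<in> A"
proof -
  obtain a where a: "a \<in> A" "center G #> x = center G #> a" using assms(4) by blast
  have "a \<in> carrier G" using a(1) assms(1) subgroup.subset by blast
  with a(2) assms(3) obtain z where "z \<in> center G" "x = z \<otimes> a" by (rule center_coset_eqD)
  then show ?thesis using subgroup.m_closed[OF assms(1) _ a(1)] assms(2) by auto
qed

lemma card_center_coset_image_eq_1: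
  assumes "subgroup A G" "card ((\<lambda>x. center G #> x) ` A) = 1"
  shows "A \<subseteq> center G"
proof
  fix a assume a: "a \<in> A"
  \<comment> \<open>A one-element image consists of the coset of \<open>\<one>\<close> alone, which
    is the center.\<close>
  have "center G #> a = center G #> \<one>"
    using assms(2) a subgroup.one_closed[OF assms(1)]
    by (metis card_1_singletonE imageI singletonD)
  also have "\<dots> = center G" using center_subset_carrier by simp
  finally show "a \<in> center G"
    using center_coset_one_iff a assms(1) subgroup.subset by blast
qed

text \<open>For a noncentral \<open>a \<in> A\<close> the image of \<open>A \<inter> centralizer G a\<close> modulo the center is a
  nontrivial subgroup of a group of prime order.\<close>
lemma commute_if_prime_center_coset_image:
  assumes A: "subgroup A G" and prime: "prime (card ((\<lambda>x. center G #> x) ` A))"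
    and a: "a \<in> A" and b: "b \<in> A"
  shows "a \<otimes> b = b \<otimes> a"
proof (cases "a \<in> center G")
  case True
  then show ?thesis using b A subgroup.subset by (fastforce simp: center_def)
next
  case False
  let ?\<pi> = "\<lambda>x. center G #> x"
  interpret Q: group "G Mod center G"
    by (rule normal.factorgroup_is_group[OF center_normal])
  have aG: "a \<in> carrier G" and bG: "b \<in> carrier G" using a b A subgroup.subset by auto
  let ?C = "A \<inter> centralizer G a"
  have C: "subgroup ?C G" using subgroups_Inter_pair[OF A subgroup_centralizer[OF aG]] .
  have "a \<in> ?C" using a aG by (simp add: centralizer_def)
  then have "card (?\<pi> ` ?C) \<noteq> 1" using card_center_coset_image_eq_1[OF C] False by blast
  moreover have "card (?\<pi> ` ?C) dvd card (?\<pi> ` A)"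
    by (rule Q.card_subgroup_dvd) (auto intro!: center_coset_image_subgroup A C)
  ultimately have "card (?\<pi> ` ?C) = card (?\<pi> ` A)" using prime by (auto simp: prime_nat_iff)
  moreover have "finite (?\<pi> ` A)" using prime card_ge_0_finite prime_gt_0_nat by blast
  ultimately have "?\<pi> ` ?C = ?\<pi> ` A" by (intro card_subset_eq) auto
  then have "?\<pi> b \<in> ?\<pi> ` centralizer G a" using b by blast
  then have "b \<in> centralizer G a"
    using mem_if_center_coset_mem_image subgroup_centralizer center_subset_centralizer aG bG
    by metis
  then show ?thesis by (simp add: centralizer_def)
qed

section \<open>Counting the centralizers\<close>

lemma card_Cent:
  assumes p: "prime p" and q: "prime q" and "p \<le> q"
    and ord: "order (G Mod center G) = p * q"
  shows "card (Cent G) = q + 2"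
proof -
  let ?\<pi> = "\<lambda>x. center G #> x"
  let ?N = "carrier G - center G"
  interpret Q: group "G Mod center G"
    by (rule normal.factorgroup_is_group[OF center_normal])
  have finQ: "finite (carrier (G Mod center G))"
    using ord p q Q.order_gt_0_iff_finite prime_gt_0_nat by simp
  have sub: "subgroup (centralizer G x) G" if "x \<in> ?N" for x
    using that subgroup_centralizer by blast
  have self: "x \<in> centralizer G x" if "x \<in> ?N" for x
    using that by (simp add: centralizer_def)
  have ZC: "center G \<subseteq> centralizer G x" if "x \<in> ?N" for x
    using that center_subset_centralizer by blast
  have fin: "finite (?\<pi> ` centralizer G x)" if "x \<in> ?N" for x
    using Q.subgroupE(1)[OF center_coset_image_subgroup[OF sub[OF that]]] finQ finite_subset by blast
  \<comment> \<open>Subgroups above the center are recovered from their images, so equalities found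
    by counting in the finite quotient lift to \<open>G\<close>, which may be infinite.\<close>
  have eqI: "A = B" if "subgroup A G" "subgroup B G" "center G \<subseteq> A" "center G \<subseteq> B"
      "?\<pi> ` A = ?\<pi> ` B" for A B
  proof -
    have sub: "A \<subseteq> B" if "subgroup A G" "subgroup B G" "center G \<subseteq> B"
      "?\<pi> ` A = ?\<pi> ` B" for A B
    proof
      fix a assume a: "a \<in> A"
      then have "?\<pi> a \<in> ?\<pi> ` B" using that(4) by blast
      moreover have "a \<in> carrier G" using a that(1) subgroup.subset by blast
      ultimately show "a \<in> B" using mem_if_center_coset_mem_image that(2,3) by blast
    qed
    show ?thesis
      using sub[OF that(1,2,4,5)] sub[OF that(2,1,3) that(5)[symmetric]] by (rule equalityI)
  qed
  \<comment> \<open>Of the divisors of \<open>p * q\<close>, 1 is excluded because the centralizer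
    contains the noncentral \<open>x\<close>, and \<open>p * q\<close> because it would force the
    centralizer to be all of \<open>G\<close>.\<close>
  have crd: "card (?\<pi> ` centralizer G x) = p \<or> card (?\<pi> ` centralizer G x) = q"
    if x: "x \<in> ?N" for x
  proof -
    have "card (?\<pi> ` centralizer G x) dvd p * q"
      unfolding ord[symmetric] order_def
      by (intro Q.card_subgroup_dvd center_coset_image_subgroup sub[OF x] Q.subgroup_self
          Q.subgroupE(1)[OF center_coset_image_subgroup[OF sub[OF x]]])
    moreover have "card (?\<pi> ` centralizer G x) \<noteq> 1"
      using card_center_coset_image_eq_1[OF sub[OF x]] self[OF x] x by blast
    moreover have "card (?\<pi> ` centralizer G x) \<noteq> p * q"
    proof
      assume "card (?\<pi> ` centralizer G x) = p * q"
      then have "?\<pi> ` centralizer G x = ?\<pi> ` carrier G"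
        unfolding center_coset_image_carrier
        using finQ ord Q.subgroupE(1)[OF center_coset_image_subgroup[OF sub[OF x]]]
        by (intro card_subset_eq) (auto simp: order_def)
      then have "centralizer G x = carrier G"
        by (intro eqI sub[OF x] subgroup_self ZC[OF x] center_subset_carrier)
      then show False using x centralizer_eq_carrier_iff by blast
    qed
    ultimately show ?thesis using prime_mult_divisors[OF p q] by blast
  qed
  have primeC: "prime (card (?\<pi> ` centralizer G x))" if "x \<in> ?N" for x
    using crd[OF that] p q by auto
  \<comment> \<open>The centralizer of \<open>x\<close> is abelian, so it lies in that of
    \<open>w\<close>. Both images have prime order and one order divides the other, so the images
    coincide.\<close>
  have same: "centralizer G x = centralizer G w"
    if x: "x \<in> ?N" and w: "w \<in> centralizer G x" "w \<notin> center G" for x w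
  proof -
    have wN: "w \<in> ?N" using w by (simp add: centralizer_def)
    have le: "centralizer G x \<subseteq> centralizer G w"
    proof
      fix y assume y: "y \<in> centralizer G x"
      have "w \<otimes> y = y \<otimes> w"
        by (rule commute_if_prime_center_coset_image[OF sub[OF x] primeC[OF x] w(1) y])
      then show "y \<in> centralizer G w" using y by (simp add: centralizer_def)
    qed
    then have "card (?\<pi> ` centralizer G x) dvd card (?\<pi> ` centralizer G w)"
      by (intro Q.card_subgroup_dvd center_coset_image_subgroup sub x wN image_mono)
    then have "card (?\<pi> ` centralizer G x) = card (?\<pi> ` centralizer G w)"
      using primeC[OF x] primeC[OF wN] by (simp add: primes_dvd_imp_eq)
    then have "?\<pi> ` centralizer G x = ?\<pi> ` centralizer G w"
      using fin[OF wN] le by (intro card_subset_eq image_mono) auto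
    then show ?thesis by (intro eqI sub ZC x wN)
  qed
  let ?F = "(\<lambda>x. ?\<pi> ` centralizer G x) ` ?N"
  \<comment> \<open>If every element were central, the quotient would have order 1 instead of
    \<open>p * q\<close>.\<close>
  have N: "?N \<noteq> {}"
  proof
    assume "?N = {}"
    then have "card (carrier (G Mod center G)) = card ((\<lambda>x. center G) ` carrier G)"
      unfolding center_coset_image_carrier[symmetric]
      using center_coset_one_iff by (intro arg_cong[where f = card] image_cong) auto
    also have "\<dots> = 1" using one_closed by (simp add: image_constant_conv) auto
    finally show False using ord p q by (auto simp: order_def)
  qed
  have "card ?F = q + 1"
  proof (rule Q.card_subgroup_partition[OF p q \<open>p \<le> q\<close> ord])
    fix A assume "A \<in> ?F"
    then show "subgroup A (G Mod center G)" "card A = p \<or> card A = q"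
      using center_coset_image_subgroup sub crd by auto
  next
    fix A B assume "A \<in> ?F" "B \<in> ?F" and ne: "A \<noteq> B"
    then obtain x y where xy: "x \<in> ?N" "y \<in> ?N"
      and A: "A = ?\<pi> ` centralizer G x" and B: "B = ?\<pi> ` centralizer G y" by auto
    have "\<one>\<^bsub>G Mod center G\<^esub> \<in> A \<inter> B"
      unfolding A B
      by (intro IntI subgroup.one_closed center_coset_image_subgroup sub xy)
    moreover have "X = \<one>\<^bsub>G Mod center G\<^esub>" if "X \<in> A" "X \<in> B" for X
    proof (rule ccontr)
      assume n: "X \<noteq> \<one>\<^bsub>G Mod center G\<^esub>"
      \<comment> \<open>A shared nontrivial coset has a noncentral representative \<open>w\<close>
        in both centralizers, and \<open>same\<close> identifies each of them with the centralizer
        of \<open>w\<close>.\<close>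
      obtain w where w: "w \<in> centralizer G x" "X = ?\<pi> w" using \<open>X \<in> A\<close> A by blast
      have wG: "w \<in> carrier G" using w(1) by (simp add: centralizer_def)
      have wy: "w \<in> centralizer G y"
        using mem_if_center_coset_mem_image[OF sub[OF xy(2)] ZC[OF xy(2)] wG] \<open>X \<in> B\<close> B w(2)
        by simp
      have "w \<notin> center G" using n w(2) wG center_coset_one_iff by (simp add: FactGroup_def)
      then have "centralizer G x = centralizer G y"
        using same[OF xy(1) w(1)] same[OF xy(2) wy] by simp
      then show False using ne A B by simp
    qed
    ultimately show "A \<inter> B = {\<one>\<^bsub>G Mod center G\<^esub>}" by blast
  next
    show "carrier (G Mod center G) \<subseteq> \<Union>?F"
    proof
      fix X assume "X \<in> carrier (G Mod center G)"
      then obtain x where x: "x \<in> carrier G" "X = ?\<pi> x"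
        unfolding center_coset_image_carrier[symmetric] by blast
      \<comment> \<open>Some noncentral \<open>n\<close> is needed to cover the trivial coset, which
        belongs to every block.\<close>
      obtain n where n: "n \<in> ?N" using N by blast
      show "X \<in> \<Union>?F"
      proof (cases "x \<in> center G")
        case True
        then have "x \<in> centralizer G n" using ZC[OF n] by blast
        with n x(2) show ?thesis by blast
      next
        case False
        with x self show ?thesis by blast
      qed
    qed
  qed
  moreover have "?F = (\<lambda>A. ?\<pi> ` A) ` (centralizer G ` ?N)" by (simp add: image_image)
  \<comment> \<open>This turns the count of blocks in the quotient into a count of centralizers in
    \<open>G\<close>.\<close>
  moreover have "inj_on (\<lambda>A. ?\<pi> ` A) (centralizer G ` ?N)"
  proof (rule inj_onI)
    fix A B assume AB: "A \<in> centralizer G ` ?N" "B \<in> centralizer G ` ?N" "?\<pi> ` A = ?\<pi> ` B"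
    then show "A = B" by (intro eqI AB(3)) (auto intro!: sub subsetD[OF ZC])
  qed
  ultimately have card_noncentral: "card (centralizer G ` ?N) = q + 1" by (simp add: card_image)
  \<comment> \<open>All central elements share the centralizer \<open>carrier G\<close>, which adds
    one to \<open>q + 1\<close>.\<close>
  have "Cent G = insert (carrier G) (centralizer G ` ?N)"
  proof -
    have "carrier G = centralizer G \<one>"
      by (auto simp: centralizer_def)
    then show ?thesis
      unfolding Cent_def using centralizer_eq_carrier_iff one_closed by blast
  qed
  moreover have "carrier G \<notin> centralizer G ` ?N"
    by (auto dest!: centralizer_eq_carrier_iff[THEN iffD1, OF _ sym])
  moreover have "finite (centralizer G ` ?N)" using card_noncentral by (intro card_ge_0_finite) simp
  ultimately show ?thesis using card_noncentral by simp
qed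

section \<open>Commutators and isoclinism with a subgroup\<close>

text \<open>A central factor moves freely through the product and meets its own inverse. Hence
  commutators depend only on cosets of the center.\<close>

lemma commutator_center_mult:
  assumes "z \<in> center G" "w \<in> center G" "x \<in> carrier G" "y \<in> carrier G"
  shows "commutator G (z \<otimes> x) (w \<otimes> y) = commutator G x y"
proof -
  have zG: "z \<in> carrier G" and wG: "w \<in> carrier G"
    using assms center_subset_carrier by auto
  have zc: "z \<otimes> u = u \<otimes> z" and wc: "w \<otimes> u = u \<otimes> w" if "u \<in> carrier G" for u
    using assms that by (auto simp: center_def)
  have left: "commutator G (z \<otimes> x) v = commutator G x v" if v: "v \<in> carrier G" for v
  proof -
    have "z \<otimes> x \<otimes> v \<otimes> inv (z \<otimes> x) = z \<otimes> (x \<otimes> v \<otimes> inv x) \<otimes> inv z"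
      using zG assms(3) v by (simp add: inv_mult_group m_assoc)
    also have "\<dots> = x \<otimes> v \<otimes> inv x"
      using zG assms(3) v zc[of "x \<otimes> v \<otimes> inv x"] by (simp add: m_assoc)
    finally show ?thesis by (simp add: commutator_def)
  qed
  have right: "commutator G x (w \<otimes> y) = commutator G x y"
  proof -
    have "x \<otimes> (w \<otimes> y) \<otimes> inv x = (x \<otimes> y \<otimes> inv x) \<otimes> w"
      using wG assms(3,4) wc[of y] wc[of "inv x"] by (simp add: m_assoc)
    moreover have "inv (w \<otimes> y) = inv w \<otimes> inv y"
      using wG assms(4) wc[of y] by (simp add: inv_mult_group)
    moreover have "w \<otimes> (inv w \<otimes> inv y) = inv y"
      using wG assms(4) by (simp add: m_assoc[symmetric])
    ultimately show ?thesis
      using wG assms(3,4) by (simp add: commutator_def m_assoc)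
  qed
  show ?thesis using left right wG assms by simp
qed

text \<open>When \<open>G\<close> is the product of its center and \<open>H\<close>, the inclusion
  of \<open>H\<close> induces an isomorphism of the central quotients, and the two commutator
  subgroups coincide.\<close>

lemma isoclinic_subgroup:
  assumes H: "subgroup H G"
    and cover: "\<And>g. g \<in> carrier G \<Longrightarrow> \<exists>z\<in>center G. \<exists>h\<in>H. g = z \<otimes> h"
  shows "isoclinic G (G\<lparr>carrier := H\<rparr>)"
proof -
  let ?H = "G\<lparr>carrier := H\<rparr>"
  let ?\<pi> = "\<lambda>x. center G #> x"
  interpret H: group ?H by (rule subgroup_imp_group[OF H])
  interpret QG: group "G Mod center G"
    by (rule normal.factorgroup_is_group[OF center_normal])
  interpret QH: group "?H Mod center ?H"
    by (rule normal.factorgroup_is_group[OF H.center_normal])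
  have HG: "H \<subseteq> carrier G" using H subgroup.subset by blast
  have ZG: "center G \<subseteq> carrier G" by (rule center_subset_carrier)
  have ZH: "center ?H = H \<inter> center G"
  proof (intro equalityI subsetI)
    fix z assume "z \<in> center ?H"
    then have z: "z \<in> H" "\<And>h. h \<in> H \<Longrightarrow> z \<otimes> h = h \<otimes> z" by (auto simp: center_def)
    have zG: "z \<in> carrier G" using z(1) HG by blast
    have "z \<otimes> g = g \<otimes> z" if gG: "g \<in> carrier G" for g
    proof -
      \<comment> \<open>\<open>z\<close> commutes with \<open>c\<close> because \<open>c\<close> is
        central in \<open>G\<close>, and with \<open>h\<close> because \<open>z\<close> is central
        in \<open>H\<close>.\<close>
      obtain c h where ch: "c \<in> center G" "h \<in> H" "g = c \<otimes> h" using cover[OF gG] by blast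
      have "c \<in> carrier G" "h \<in> carrier G" "c \<otimes> z = z \<otimes> c"
        using ch HG zG by (auto simp: center_def)
      then show ?thesis using z(2)[OF ch(2)] ch(3) zG by (metis m_assoc)
    qed
    then show "z \<in> H \<inter> center G" using z(1) zG by (simp add: center_def)
  qed (use HG in \<open>auto simp: center_def\<close>)
  \<comment> \<open>The quotient map restricted to \<open>H\<close> is onto and has kernel
    \<open>center ?H\<close>, so the first isomorphism theorem applies.\<close>
  interpret h: group_hom ?H "G Mod center G" ?\<pi>
    using normal.r_coset_hom_Mod[OF center_normal] HG
    by unfold_locales (auto simp: hom_def Pi_def subset_iff)
  have surj: "?\<pi> ` carrier ?H = carrier (G Mod center G)"
  proof
    show "?\<pi> ` carrier ?H \<subseteq> carrier (G Mod center G)" by auto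
    show "carrier (G Mod center G) \<subseteq> ?\<pi> ` carrier ?H"
    proof
      fix X assume "X \<in> carrier (G Mod center G)"
      then obtain g where g: "g \<in> carrier G" "X = ?\<pi> g"
        unfolding center_coset_image_carrier[symmetric] by blast
      obtain c h where ch: "c \<in> center G" "h \<in> H" "g = c \<otimes> h" using cover[OF g(1)] by blast
      have "?\<pi> g = ?\<pi> c #> h" using ch HG ZG by (simp add: coset_mult_assoc subset_iff)
      also have "?\<pi> c = center G" using ch(1) ZG center_coset_one_iff by blast
      finally show "X \<in> ?\<pi> ` carrier ?H" using g(2) ch(2) by auto
    qed
  qed
  have ker: "kernel ?H (G Mod center G) ?\<pi> = center ?H"
    using HG ZH center_coset_one_iff by (auto simp: kernel_def FactGroup_def subset_iff)
  \<comment> \<open>The induced map: \<open>?\<pi>\<close> is constant on each coset of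
    \<open>center ?H\<close>, so its image there is a singleton.\<close>
  define \<theta> where "\<theta> = (\<lambda>X. the_elem (?\<pi> ` X))"
  have \<theta>: "\<theta> \<in> iso (?H Mod center ?H) (G Mod center G)"
    using h.FactGroup_iso_set[OF surj] unfolding ker \<theta>_def .
  define \<phi> where "\<phi> = inv_into (carrier (?H Mod center ?H)) \<theta>"
  have \<phi>: "\<phi> \<in> iso (G Mod center G) (?H Mod center ?H)"
    unfolding \<phi>_def by (rule QH.iso_set_sym[OF \<theta>])
  have \<theta>_coset: "\<theta> (center ?H #>\<^bsub>?H\<^esub> y) = ?\<pi> y" if y: "y \<in> H" for y
  proof -
    have "?\<pi> ` (center ?H #>\<^bsub>?H\<^esub> y) = {?\<pi> y}"
    proof -
      have "?\<pi> (z \<otimes> y) = ?\<pi> y" if "z \<in> center G" for z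
      proof -
        have "?\<pi> (z \<otimes> y) = ?\<pi> z #> y" using that y HG ZG by (simp add: coset_mult_assoc subset_iff)
        also have "?\<pi> z = center G" using that ZG center_coset_one_iff by blast
        finally show ?thesis .
      qed
      moreover have "y \<in> center ?H #>\<^bsub>?H\<^esub> y"
        using H.rcos_self[OF _ H.center_subgroup] y by simp
      ultimately show ?thesis by (auto simp: r_coset_def ZH)
    qed
    then show ?thesis by (simp add: \<theta>_def)
  qed
  \<comment> \<open>Since \<open>\<phi>\<close> inverts \<open>\<theta>\<close>, elements matched by
    \<open>\<phi>\<close> lie in one coset of \<open>center G\<close> and so are interchangeable
    inside commutators.\<close>
  have \<phi>D: "?\<pi> g = ?\<pi> y"
    if g: "g \<in> carrier G" and y: "y \<in> H" and eq: "\<phi> (?\<pi> g) = center ?H #>\<^bsub>?H\<^esub> y" for g y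
  proof -
    have "?\<pi> g \<in> \<theta> ` carrier (?H Mod center ?H)"
      using \<theta> g center_coset_image_carrier by (auto simp: iso_def bij_betw_def)
    then have "\<theta> (\<phi> (?\<pi> g)) = ?\<pi> g" unfolding \<phi>_def by (rule f_inv_into_f)
    then show ?thesis using eq \<theta>_coset[OF y] by simp
  qed
  have comm_H: "commutator ?H x y = commutator G x y" if "x \<in> H" "y \<in> H" for x y
    using that H by (simp add: commutator_def)
  have comm: "commutator G g1 g2 = commutator G h1 h2"
    if gh: "g1 \<in> carrier G" "g2 \<in> carrier G" "h1 \<in> carrier G" "h2 \<in> carrier G"
      "?\<pi> g1 = ?\<pi> h1" "?\<pi> g2 = ?\<pi> h2" for g1 g2 h1 h2
  proof -
    obtain z where "z \<in> center G" "g1 = z \<otimes> h1" using center_coset_eqD gh by metis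
    moreover obtain w where "w \<in> center G" "g2 = w \<otimes> h2" using center_coset_eqD gh by metis
    ultimately show ?thesis using commutator_center_mult gh by simp
  qed
  \<comment> \<open>Dropping the central factors writes each commutator of \<open>G\<close> as one
    of elements of \<open>H\<close>.\<close>
  have "derived_set G (carrier G) \<subseteq> derived_set G H"
  proof
    fix c assume "c \<in> derived_set G (carrier G)"
    then obtain g1 g2 where g: "g1 \<in> carrier G" "g2 \<in> carrier G" "c = commutator G g1 g2"
      by (auto simp: commutator_def)
    obtain z1 h1 where 1: "z1 \<in> center G" "h1 \<in> H" "g1 = z1 \<otimes> h1" using cover[OF g(1)] by blast
    obtain z2 h2 where 2: "z2 \<in> center G" "h2 \<in> H" "g2 = z2 \<otimes> h2" using cover[OF g(2)] by blast
    have "c = commutator G h1 h2"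
      using g(3) 1 2 HG commutator_center_mult by (simp add: subset_iff)
    then show "c \<in> derived_set G H" using 1 2 by (auto simp: commutator_def)
  qed
  then have "derived_set G (carrier G) = derived_set G H"
    using mono_derived_set[OF HG] by blast
  then have "derived ?H H = derived G (carrier G)"
    using derived_consistent[OF subset_refl H] by (simp add: derived_def)
  then have "commutator_subgroup ?H = commutator_subgroup G"
    by (simp add: commutator_subgroup_def)
  then have id: "(\<lambda>x. x) \<in> iso (commutator_subgroup G) (commutator_subgroup ?H)"
    by (simp add: iso_def hom_def bij_betw_def)
  show ?thesis
    unfolding isoclinic_def
  proof (rule bexI[OF _ \<phi>], rule bexI[OF _ id], intro ballI impI)
    fix g1 g2 h1 h2
    assume g: "g1 \<in> carrier G" "g2 \<in> carrier G" and "h1 \<in> carrier ?H" "h2 \<in> carrier ?H"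
      and e: "\<phi> (?\<pi> g1) = center ?H #>\<^bsub>?H\<^esub> h1" "\<phi> (?\<pi> g2) = center ?H #>\<^bsub>?H\<^esub> h2"
    then have h: "h1 \<in> H" "h2 \<in> H" by auto
    show "commutator G g1 g2 = commutator ?H h1 h2"
      using comm[OF g _ _ \<phi>D[OF g(1) h(1) e(1)] \<phi>D[OF g(2) h(2) e(2)]] h HG comm_H by auto
  qed
qed

lemma nonabelian_subgroup_cover:
  assumes p: "prime p" and q: "prime q" and ord: "order (G Mod center G) = p * q"
    and H: "subgroup H G" and nonab: "\<not> comm_group (G\<lparr>carrier := H\<rparr>)"
    and g: "g \<in> carrier G"
  shows "\<exists>z\<in>center G. \<exists>h\<in>H. g = z \<otimes> h"
proof -
  let ?\<pi> = "\<lambda>x. center G #> x"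
  interpret Q: group "G Mod center G"
    by (rule normal.factorgroup_is_group[OF center_normal])
  have finQ: "finite (carrier (G Mod center G))"
    using ord p q Q.order_gt_0_iff_finite prime_gt_0_nat by simp
  have HG: "H \<subseteq> carrier G" using H subgroup.subset by blast
  have QH: "subgroup (?\<pi> ` H) (G Mod center G)" by (rule center_coset_image_subgroup[OF H])
  have nc: "\<not> (\<forall>a\<in>H. \<forall>b\<in>H. a \<otimes> b = b \<otimes> a)"
    using nonab group.group_comm_groupI[OF subgroup_imp_group[OF H]] by auto
  \<comment> \<open>Order 1 would make \<open>H\<close> central and prime order would make it
    abelian, so the image of \<open>H\<close> is the whole quotient.\<close>
  have "card (?\<pi> ` H) dvd p * q"
    unfolding ord[symmetric] order_def
    by (intro Q.card_subgroup_dvd QH Q.subgroup_self Q.subgroupE(1)[OF QH])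
  moreover have "card (?\<pi> ` H) \<noteq> 1"
    using card_center_coset_image_eq_1[OF H] nc HG by (force simp: center_def)
  moreover have "\<not> prime (card (?\<pi> ` H))"
    using commute_if_prime_center_coset_image[OF H] nc by blast
  ultimately have "card (?\<pi> ` H) = p * q" using prime_mult_divisors[OF p q] p q by metis
  then have "?\<pi> ` H = carrier (G Mod center G)"
    using finQ ord Q.subgroupE(1)[OF QH] by (intro card_subset_eq) (auto simp: order_def)
  then obtain h where h: "h \<in> H" "?\<pi> g = ?\<pi> h"
    using center_coset_image_carrier g by (metis imageE imageI)
  then show ?thesis using center_coset_eqD[OF h(2) g] HG by blast
qed

end

section \<open>Transfer of the count to the subgroup\<close>

lemma isoclinic_order_eq:
  assumes "isoclinic G H"
  shows "order (G Mod center G) = order (H Mod center H)"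
proof -
  obtain \<phi> where "\<phi> \<in> iso (G Mod center G) (H Mod center H)"
    using assms unfolding isoclinic_def by blast
  then show ?thesis unfolding iso_def order_def by (blast dest: bij_betw_same_card)
qed

theorem theorem3p7:
  fixes G :: "('a, 'm) monoid_scheme" and H :: "'a set" and p q :: nat
  assumes "prime p" and "prime q" and "p \<le> q"
    and "group G"
    and "order (G Mod center G) = p * q"
    and "subgroup H G"
    and "\<not> comm_group (G\<lparr>carrier := H\<rparr>)"
  shows "isoclinic G (G\<lparr>carrier := H\<rparr>)
    \<and> card (Cent G) = q + 2
    \<and> card (Cent (G\<lparr>carrier := H\<rparr>)) = q + 2"
proof -
  interpret group G by fact
  interpret H: group "G\<lparr>carrier := H\<rparr>" by (rule subgroup_imp_group[OF assms(6)])
  have iso: "isoclinic G (G\<lparr>carrier := H\<rparr>)"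
    using isoclinic_subgroup[OF assms(6)] nonabelian_subgroup_cover[OF assms(1,2,5,6,7)] by blast
  \<comment> \<open>Isoclinism carries the order of the central quotient over to \<open>H\<close>,
    so the centralizer count applies to \<open>H\<close> as a group in its own right.\<close>
  then have "order (G\<lparr>carrier := H\<rparr> Mod center (G\<lparr>carrier := H\<rparr>)) = p * q"
    using isoclinic_order_eq assms(5) by metis
  then show ?thesis
    using iso card_Cent[OF assms(1-3,5)] H.card_Cent[OF assms(1-3)] by blast
qed

end
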